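(* Let $H_1,H_2$ be real Hilbert spaces, $C:H_1\to H_2$ a bounded linear mapping with adjoint $C^T:H_2\to H_1$, and $\mathcal{M}:H_2\rightrightarrows H_2$ a maximal monotone operator. Let $\lambda>0$ and $y\in H_1$ be given. Choose $\mu>0$ such that $\lambda\mu\in(0,2/\|C\|^2)$, and let $(\alpha_k)\subset(0,1)$ satisfy $\sum_{k=1}^\infty\alpha_k(1-\alpha_k)=\infty$. Let $\mathcal{N}:H_2\to H_2$ be defined by $$\mathcal{N}(v):=\mathcal{M}_{\frac1\mu}\Big(Cy+\big(\tfrac1\mu I-\lambda CC^T\big)v\Big),$$ and construct the sequence $(v_k)$ as follows (Algorithm 1): $$v_0\in H_2,\qquad v_{k+1}=(1-\alpha_k)v_k+\alpha_k\mathcal{N}(v_k),\qquad k=0,1,2,\ldots$$ Then the sequence $(v_k)$ converges weakly to a fixed point $v$ of $\mathcal{N}$, and $J_{\lambda C^T\mathcal{M}C}\,y=y-\lambda C^Tv$. Furthermore, if $\inf\alpha_k>0$, then the sequence $(x_k)$ defined by $x_k:=y-\lambda C^Tv_k$ converges strongly to $J_{\lambda C^T\mathcal{M}C}\,y$.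
   Context: The composite $C^T\mathcal{M}C:H_1\rightrightarrows H_1$ is $C^T\mathcal{M}C(x)=\{C^Tu^*: u^*\in\mathcal{M}(Cx)\}$. The resolvent of an operator $\mathcal{A}$ is $J_{\mathcal{A}}=(I+\mathcal{A})^{-1}$, so $x=J_{\lambda C^T\mathcal{M}C}\,y$ means that $x\in H_1$ satisfies $y\in x+\lambda C^T\mathcal{M}Cx$. The Yosida approximation of $\mathcal{M}$ of index $\alpha>0$ is the single-valued map $\mathcal{M}_\alpha=\frac1\alpha(I-J_{\alpha\mathcal{M}})=(\alpha I+\mathcal{M}^{-1})^{-1}$.
   Formalization: It is additionally assumed that the resolvent of λC^T M C exists at y, i.e. some x satisfies y ∈ x + λC^T M C x; otherwise N may have no fixed point (C x=(x,0), M the normal cone of {b=1} in R^2). *)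

theory Defs
  imports "HOL-Analysis.Analysis"
begin

text \<open>A set-valued operator on a space is a function into sets; its graph is the set of pairs
  \<open>(x, u)\<close> with \<open>u \<in> A x\<close>.\<close>

type_synonym ('a, 'b) multimap = "'a \<Rightarrow> 'b set"

definition monotone_operator :: "('a::real_inner, 'a) multimap \<Rightarrow> bool" where
  "monotone_operator A \<longleftrightarrow> (\<forall>x y. \<forall>u\<in>A x. \<forall>v\<in>A y. 0 \<le> (x - y) \<bullet> (u - v))"

text \<open>Maximality is with respect to inclusion of graphs, i.e. pointwise inclusion of values.\<close>

definition maximal_monotone :: "('a::real_inner, 'a) multimap \<Rightarrow> bool" where
  "maximal_monotone A \<longleftrightarrow>
     monotone_operator A \<and> (\<forall>B. monotone_operator B \<and> (\<forall>x. A x \<subseteq> B x) \<longrightarrow> B = A)"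

definition scale_operator :: "real \<Rightarrow> ('a, 'b::real_vector) multimap \<Rightarrow> ('a, 'b) multimap" where
  "scale_operator c A x = (\<lambda>u. c *\<^sub>R u) ` A x"

definition inverse_operator :: "('a, 'b) multimap \<Rightarrow> ('b, 'a) multimap" where
  "inverse_operator A u = {x. u \<in> A x}"

definition composite_operator ::
  "('a::real_inner \<Rightarrow> 'b::real_inner) \<Rightarrow> ('b, 'b) multimap \<Rightarrow> ('a, 'a) multimap" where
  "composite_operator C M x = {adjoint C u | u. u \<in> M (C x)}"

text \<open>\<open>resolvent_set A\<close> is the set-valued operator \<open>(I + A)\<inverse>\<close>. Its value may be empty for a general
  \<open>A\<close>. The function \<open>resolvent A\<close> is meaningful exactly at the points where that value is a singleton.\<close>

definition resolvent_set :: "('a::real_vector, 'a) multimap \<Rightarrow> ('a, 'a) multimap" where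
  "resolvent_set A = inverse_operator (\<lambda>x. {x + u | u. u \<in> A x})"

definition resolvent :: "('a::real_vector, 'a) multimap \<Rightarrow> 'a \<Rightarrow> 'a" where
  "resolvent A y = the_elem (resolvent_set A y)"

definition yosida :: "real \<Rightarrow> ('a::real_vector, 'a) multimap \<Rightarrow> 'a \<Rightarrow> 'a" where
  "yosida \<alpha> A x = (1 / \<alpha>) *\<^sub>R (x - resolvent (scale_operator \<alpha> A) x)"

definition converges_weakly :: "(nat \<Rightarrow> 'a::real_normed_vector) \<Rightarrow> 'a \<Rightarrow> bool" where
  "converges_weakly v l \<longleftrightarrow>
     (\<forall>f :: 'a \<Rightarrow> real. bounded_linear f \<longrightarrow> (\<lambda>k. f (v k)) \<longlonglongrightarrow> f l)"

end

theory Submission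
  imports Defs
begin

text \<open>The map \<open>N\<close> is a dual fixed-point map: \<open>N w = w\<close> says exactly that \<open>w \<in> M (C x)\<close> for
  \<open>x = y - lam C\<^sup>T w\<close>, that is, that \<open>x\<close> solves the resolvent inclusion and \<open>w\<close> is the multiplier
  certifying it (\<open>dual_map_fixed_point_iff\<close>). So a point of the resolvent set yields a fixed point
  of \<open>N\<close>, and any fixed point of \<open>N\<close> yields the resolvent, which is unique by monotonicity.

  Cocoercivity of the Yosida approximation gives the estimate
  \<open>|N u - N w|\<^sup>2 \<le> |u - w|\<^sup>2 - s (2 - s |C|\<^sup>2) |C\<^sup>T (u - w)|\<^sup>2\<close> with \<open>s = lam \<mu>\<close>
  (\<open>dual_map_estimate\<close>). Its correction term has the right sign by the choice of \<open>\<mu>\<close>, so \<open>N\<close> is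
  nonexpansive, and the recursion for \<open>v\<close> is a Krasnoselskii--Mann iteration. Such an iteration is
  Fejer monotone with respect to the fixed points, and its residuals \<open>v k - N (v k)\<close> tend to zero;
  by demiclosedness every weak cluster point is a fixed point, and by Opial's argument there is
  only one cluster point (\<open>converges_weakly_to_fixed_point\<close>). Strong convergence of \<open>C\<^sup>T (v k)\<close> comes
  from the correction term again: when the relaxation parameters stay away from zero,
  \<open>|C\<^sup>T (v k - l)|\<^sup>2\<close> is at most a constant times the decrease of \<open>|v k - l|\<^sup>2\<close> in one step, and that
  decrease tends to zero.

  Three facts about Hilbert spaces stand behind this: the Riesz representation theorem, which
  provides the adjoint; Minty's theorem, which makes the Yosida approximation defined everywhere;
  and the weak compactness of bounded sets. The first two are both read off from the optimality
  condition for minimising \<open>|w|\<^sup>2 + c\<close> over a convex set of pairs \<open>(w, c)\<close>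
  (\<open>convex_quadratic_minimum\<close>); the third is Tychonoff's theorem followed by Riesz.\<close>

section \<open>Minimising a quadratic function over a convex set\<close>

text \<open>The minimum of the strongly convex function \<open>|w|\<^sup>2 + c\<close> over \<open>S\<close> need not be attained, as \<open>S\<close>
  may fail to be closed. Strong convexity nevertheless makes minimising sequences Cauchy, and the
  first-order optimality condition survives at their limit \<open>(z, I - |z|\<^sup>2)\<close>, where \<open>I\<close> is the
  infimum: moving from the limit towards \<open>(w, c) \<in> S\<close> does not decrease the function. This is the
  inequality below with \<open>I\<close> in place of its lower bound \<open>m\<close>. Keeping \<open>c\<close> as a separate coordinate
  lets one statement serve both Riesz and Minty.\<close>

lemma convex_quadratic_minimum:
  fixes S :: "('b::{real_inner, complete_space} \<times> real) set"
  assumes "convex S" and bound: "\<And>w c. (w, c) \<in> S \<Longrightarrow> m \<le> (norm w)\<^sup>2 + c"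
  shows "\<exists>z. \<forall>(w, c) \<in> S. (norm z)\<^sup>2 + m \<le> 2 * (z \<bullet> w) + c"
proof (cases "S = {}")
  case False
  define q :: "'b \<times> real \<Rightarrow> real" where "q = (\<lambda>p. (norm (fst p))\<^sup>2 + snd p)"
  define I where "I = Inf (q ` S)"
  have bdd: "bdd_below (q ` S)"
    using bound by (intro bdd_belowI2[where m = m]) (auto simp: q_def)
  have I_le: "I \<le> q p" if "p \<in> S" for p
    unfolding I_def using bdd that by (intro cInf_lower) auto
  have m_le: "m \<le> I"
    unfolding I_def using False bound by (intro cInf_greatest) (auto simp: q_def)
  have "\<exists>p\<in>S. q p < I + 1 / real (Suc n)" for n
    using cInf_lessD[of "q ` S" "I + 1 / real (Suc n)"] False unfolding I_def by auto
  then obtain p where p: "\<And>n. p n \<in> S" "\<And>n. q (p n) < I + 1 / real (Suc n)"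
    by metis
  define w where "w n = fst (p n)" for n
  define c where "c n = snd (p n)" for n
  have inv_lim: "(\<lambda>n. 1 / real (Suc n)) \<longlonglongrightarrow> 0"
    using LIMSEQ_inverse_real_of_nat by (simp add: inverse_eq_divide)
  \<comment> \<open>The midpoint of two nearly optimal points cannot be better than optimal, so by the
    parallelogram law the two points are close.\<close>
  have gap: "(norm (w i - w j))\<^sup>2 \<le> 2 * (1 / real (Suc i) + 1 / real (Suc j))" for i j
  proof -
    have "(1/2) *\<^sub>R p i + (1/2) *\<^sub>R p j \<in> S"
      using \<open>convex S\<close> p(1) by (intro convexD) auto
    then have "I \<le> q ((1/2) *\<^sub>R p i + (1/2) *\<^sub>R p j)"
      by (rule I_le)
    also have "\<dots> = q (p i) / 2 + q (p j) / 2 - (norm (w i - w j))\<^sup>2 / 4"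
      by (simp add: q_def w_def power2_norm_eq_inner inner_simps inner_commute field_simps)
    finally show ?thesis
      using p(2)[of i] p(2)[of j] by simp
  qed
  have "Cauchy w"
  proof (rule metric_CauchyI)
    fix e :: real assume "0 < e"
    then have "eventually (\<lambda>n. 1 / real (Suc n) < e\<^sup>2 / 4) sequentially"
      by (intro order_tendstoD(2)[OF inv_lim]) simp
    then obtain n0 where n0: "\<And>n. n \<ge> n0 \<Longrightarrow> 1 / real (Suc n) < e\<^sup>2 / 4"
      by (auto simp: eventually_sequentially)
    have "dist (w i) (w j) < e" if "i \<ge> n0" "j \<ge> n0" for i j
    proof -
      note gap[of i j]
      also have "2 * (1 / real (Suc i) + 1 / real (Suc j)) < 2 * (e\<^sup>2 / 4 + e\<^sup>2 / 4)"
        by (intro mult_strict_left_mono add_strict_mono n0 that) simp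
      finally have "(norm (w i - w j))\<^sup>2 < e\<^sup>2"
        by simp
      then show ?thesis
        using \<open>0 < e\<close> by (simp add: dist_norm power_less_imp_less_base)
    qed
    then show "\<exists>n0. \<forall>i\<ge>n0. \<forall>j\<ge>n0. dist (w i) (w j) < e"
      by blast
  qed
  then obtain z where z: "w \<longlonglongrightarrow> z"
    using Cauchy_convergent convergent_def by blast
  have "(\<lambda>n. q (p n)) \<longlonglongrightarrow> I"
  proof (rule tendsto_sandwich[where f = "\<lambda>_. I" and h = "\<lambda>n. I + 1 / real (Suc n)"])
    show "(\<lambda>n. I + 1 / real (Suc n)) \<longlonglongrightarrow> I"
      using tendsto_add[OF tendsto_const inv_lim] by simp
  qed (use I_le p in \<open>auto intro!: always_eventually less_imp_le\<close>)
  then have "(\<lambda>n. q (p n) - (norm (w n))\<^sup>2) \<longlonglongrightarrow> I - (norm z)\<^sup>2"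
    by (intro tendsto_intros z)
  then have c_lim: "c \<longlonglongrightarrow> I - (norm z)\<^sup>2"
    by (simp add: q_def w_def c_def[abs_def])
  have "(norm z)\<^sup>2 + m \<le> 2 * (z \<bullet> x) + d" if xd: "(x, d) \<in> S" for x d
  proof -
    \<comment> \<open>The segment from \<open>p n\<close> to \<open>(x, d)\<close> lies in \<open>S\<close>; comparing values along it, letting
      \<open>n\<close> tend to infinity and dividing by the step \<open>s\<close> leaves an error of order \<open>s\<close>.\<close>
    have step: "(norm z)\<^sup>2 + I \<le> 2 * (z \<bullet> x) + d + s * (norm (x - z))\<^sup>2" if s: "0 < s" "s \<le> 1" for s
    proof -
      have "I \<le> (norm ((1 - s) *\<^sub>R w n + s *\<^sub>R x))\<^sup>2 + ((1 - s) * c n + s * d)" for n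
      proof -
        have "(1 - s) *\<^sub>R p n + s *\<^sub>R (x, d) \<in> S"
          using \<open>convex S\<close> p(1) xd s by (intro convexD) auto
        from I_le[OF this] show ?thesis
          by (simp add: q_def w_def c_def)
      qed
      then have "I \<le> (norm ((1 - s) *\<^sub>R z + s *\<^sub>R x))\<^sup>2 + ((1 - s) * (I - (norm z)\<^sup>2) + s * d)"
        by (intro LIMSEQ_le_const[where X = "\<lambda>n. (norm ((1 - s) *\<^sub>R w n + s *\<^sub>R x))\<^sup>2 + ((1 - s) * c n + s * d)"]
              tendsto_intros z c_lim) auto
      also have "\<dots> = I + s * (2 * (z \<bullet> x) + d + s * (norm (x - z))\<^sup>2 - ((norm z)\<^sup>2 + I))"
        unfolding power2_norm_eq_inner
        by (simp add: inner_simps inner_commute algebra_simps power2_eq_square)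
      finally show ?thesis
        using s by (simp add: zero_le_mult_iff)
    qed
    have "(\<lambda>n. 2 * (z \<bullet> x) + d + 1 / real (Suc n) * (norm (x - z))\<^sup>2) \<longlonglongrightarrow> 2 * (z \<bullet> x) + d + 0 * (norm (x - z))\<^sup>2"
      by (intro tendsto_intros inv_lim)
    then have "(norm z)\<^sup>2 + I \<le> 2 * (z \<bullet> x) + d + 0 * (norm (x - z))\<^sup>2"
      by (rule LIMSEQ_le_const) (intro exI[of _ 0] allI impI step, simp_all)
    then show ?thesis
      using m_le by simp
  qed
  then show ?thesis
    by blast
qed simp

section \<open>Riesz representation and adjoints\<close>

text \<open>The representing vector minimises \<open>|w|\<^sup>2 - 2 f w\<close>. The optimality condition over the graph of
  \<open>- 2 f\<close>, a linear subspace, bounds the linear functional \<open>w \<mapsto> z \<bullet> w - f w\<close> from below, and a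
  linear functional bounded below vanishes.\<close>

lemma riesz_representation:
  fixes f :: "'a::{real_inner, complete_space} \<Rightarrow> real"
  assumes f: "bounded_linear f"
  shows "\<exists>z. \<forall>x. f x = z \<bullet> x"
proof -
  interpret f: bounded_linear f by fact
  define S where "S = range (\<lambda>w. (w, - 2 * f w))"
  have "linear (\<lambda>w. (w, - 2 * f w))"
    by (rule linearI) (simp_all add: f.add f.scale)
  then have "convex S"
    unfolding S_def by (intro convex_linear_image) auto
  moreover obtain K where K: "\<And>x. norm (f x) \<le> norm x * K"
    using f.bounded by blast
  have "- K\<^sup>2 \<le> (norm w)\<^sup>2 + c" if "(w, c) \<in> S" for w c
  proof -
    have "0 \<le> (norm w - K)\<^sup>2"
      by simp
    moreover have "\<bar>f w\<bar> \<le> norm w * K"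
      using K[of w] by simp
    ultimately show ?thesis
      using that by (auto simp: S_def power2_diff)
  qed
  ultimately obtain z where z: "\<And>w. (norm z)\<^sup>2 + - K\<^sup>2 \<le> 2 * (z \<bullet> w) + (- 2 * f w)"
    using convex_quadratic_minimum[of S "- K\<^sup>2"] unfolding S_def by auto
  have "f x = z \<bullet> x" for x
  proof (rule ccontr)
    define d where "d = 2 * (z \<bullet> x - f x)"
    assume "f x \<noteq> z \<bullet> x"
    then have d: "d \<noteq> 0"
      by (simp add: d_def)
    \<comment> \<open>At the multiple \<open>t x\<close> the functional \<open>w \<mapsto> 2 (z \<bullet> w - f w)\<close> lies one below its lower bound.\<close>
    define t where "t = ((norm z)\<^sup>2 - K\<^sup>2 - 1) / d"
    have "(norm z)\<^sup>2 - K\<^sup>2 \<le> t * d"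
      using z[of "t *\<^sub>R x"] by (simp add: f.scale d_def algebra_simps)
    then show False
      using d by (simp add: t_def)
  qed
  then show ?thesis
    by blast
qed

text \<open>The adjoint is defined by a choice operator, so its characteristic property rests on the
  existence of some adjoint, which Riesz supplies one vector \<open>u\<close> at a time.\<close>

lemma adjoint_inner:
  fixes C :: "'a::{real_inner, complete_space} \<Rightarrow> 'b::real_inner"
  assumes "bounded_linear C"
  shows "C x \<bullet> u = x \<bullet> adjoint C u"
proof -
  have "\<exists>z. \<forall>x. C x \<bullet> u = z \<bullet> x" for u
    using assms by (intro riesz_representation) (rule bounded_linear_inner_left_comp)
  then have "\<exists>g. \<forall>x u. C x \<bullet> u = x \<bullet> g u"
    by (metis inner_commute)
  then have "\<forall>x u. C x \<bullet> u = x \<bullet> adjoint C u"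
    unfolding adjoint_def by (rule someI_ex)
  then show ?thesis
    by blast
qed

lemma adjoint_diff:
  fixes C :: "'a::{real_inner, complete_space} \<Rightarrow> 'b::real_inner"
  assumes "bounded_linear C"
  shows "adjoint C (u - w) = adjoint C u - adjoint C w"
  by (rule vector_eq_ldot[THEN iffD1])
    (simp add: inner_diff_right flip: adjoint_inner[OF assms])

section \<open>Minty's surjectivity theorem\<close>

text \<open>The points of the graph carry the value \<open>a \<bullet> b\<close> as a third coordinate into the hull, because the
  inner product itself is not affine along segments.\<close>

definition inner_graph_hull :: "('b::real_inner \<times> 'b) set \<Rightarrow> ('b \<times> 'b \<times> real) set" where
  "inner_graph_hull G = convex hull ((\<lambda>(a, b). (a, b, a \<bullet> b)) ` G)"

text \<open>Monotonicity of \<open>G\<close>, with the inner product expanded, says that the expression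
  \<open>c + c' - a \<bullet> b' - a' \<bullet> b\<close> is nonnegative for any two lifted points. This expression is affine in
  each of the triples \<open>(a, b, c)\<close> and \<open>(a', b', c')\<close> separately, so its nonnegativity passes to the
  convex hull in one triple and then in the other. The diagonal case is the claim.\<close>

lemma inner_le_of_mem_inner_graph_hull:
  assumes mono: "\<And>a b a' b'. (a, b) \<in> G \<Longrightarrow> (a', b') \<in> G \<Longrightarrow> 0 \<le> (a - a') \<bullet> (b - b')"
    and mem: "(a, b, c) \<in> inner_graph_hull G"
  shows "a \<bullet> b \<le> c"
proof -
  define E where "E = (\<lambda>(a, b). (a, b, a \<bullet> b)) ` G"
  define H :: "'a \<times> 'a \<times> real \<Rightarrow> ('a \<times> 'a \<times> real) set" where
    "H p = {p'. fst p \<bullet> fst (snd p') + fst p' \<bullet> fst (snd p) \<le> snd (snd p) + snd (snd p')}" for p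
  have convex_H: "convex (H p)" for p
  proof -
    define f where "f p' = fst p \<bullet> fst (snd p') + fst p' \<bullet> fst (snd p) - snd (snd p')" for p'
    have "linear f"
      by (rule linearI) (simp_all add: f_def inner_simps algebra_simps)
    then have "convex (f -` {..snd (snd p)})"
      by (intro convex_linear_vimage) auto
    moreover have "H p = f -` {..snd (snd p)}"
      by (auto simp: H_def f_def)
    ultimately show ?thesis
      by simp
  qed
  have sym: "p \<in> H p' \<longleftrightarrow> p' \<in> H p" for p p'
    by (auto simp: H_def inner_commute algebra_simps split: prod.splits)
  have "E \<subseteq> H p" if "p \<in> E" for p
    using that mono by (fastforce simp: E_def H_def inner_simps inner_commute)
  then have "convex hull E \<subseteq> H p" if "p \<in> E" for p
    using that convex_H by (intro hull_minimal)
  then have "E \<subseteq> H p" if "p \<in> convex hull E" for p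
    using that sym by blast
  then have "convex hull E \<subseteq> H p" if "p \<in> convex hull E" for p
    using that convex_H by (intro hull_minimal)
  then have "(a, b, c) \<in> H (a, b, c)"
    using mem by (auto simp: inner_graph_hull_def E_def)
  then show ?thesis
    by (simp add: H_def inner_commute)
qed

text \<open>A point \<open>(x, - x)\<close> monotonically related to all of \<open>G\<close> is the heart of Minty's theorem. Expanding
  the product turns the requirement into \<open>|x|\<^sup>2 \<le> 2 x \<bullet> w + c\<close> for \<open>w = (a - b) / 2\<close> and
  \<open>c = a \<bullet> b\<close>, which is the optimality condition for minimising \<open>|w|\<^sup>2 + c\<close> over the convex hull of
  these pairs. The minimum is nonnegative because \<open>|(a - b) / 2|\<^sup>2 + a \<bullet> b = |(a + b) / 2|\<^sup>2\<close>, and on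
  the hull \<open>c\<close> dominates \<open>a \<bullet> b\<close>.\<close>

lemma monotone_graph_related_antidiagonal_point:
  fixes G :: "('b::{real_inner, complete_space} \<times> 'b) set"
  assumes mono: "\<And>a b a' b'. (a, b) \<in> G \<Longrightarrow> (a', b') \<in> G \<Longrightarrow> 0 \<le> (a - a') \<bullet> (b - b')"
  shows "\<exists>x. \<forall>(a, b) \<in> G. 0 \<le> (a - x) \<bullet> (b + x)"
proof -
  define L :: "'b \<times> 'b \<times> real \<Rightarrow> 'b \<times> real" where "L = (\<lambda>(a, b, c). ((1/2) *\<^sub>R (a - b), c))"
  have "linear L"
    by (rule linearI) (auto simp: L_def algebra_simps split: prod.splits)
  then have "convex (L ` inner_graph_hull G)"
    unfolding inner_graph_hull_def by (intro convex_linear_image convex_convex_hull)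
  moreover have "0 \<le> (norm w)\<^sup>2 + c" if wc: "(w, c) \<in> L ` inner_graph_hull G" for w c
  proof -
    obtain a b where ab: "(a, b, c) \<in> inner_graph_hull G" "w = (1/2) *\<^sub>R (a - b)"
      using wc by (auto simp: L_def)
    have "(norm w)\<^sup>2 + a \<bullet> b = (norm ((1/2) *\<^sub>R (a + b)))\<^sup>2"
      unfolding power2_norm_eq_inner ab(2) by (simp add: inner_simps inner_commute field_simps)
    then show ?thesis
      using inner_le_of_mem_inner_graph_hull[OF mono ab(1)]
      by (smt (verit) zero_le_power2)
  qed
  ultimately obtain x where x: "\<And>w c. (w, c) \<in> L ` inner_graph_hull G \<Longrightarrow> (norm x)\<^sup>2 + 0 \<le> 2 * (x \<bullet> w) + c"
    using convex_quadratic_minimum[of "L ` inner_graph_hull G" 0] by blast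
  have "0 \<le> (a - x) \<bullet> (b + x)" if "(a, b) \<in> G" for a b
  proof -
    have "(a, b, a \<bullet> b) \<in> inner_graph_hull G"
      unfolding inner_graph_hull_def using that by (intro hull_inc) force
    then have "((1/2) *\<^sub>R (a - b), a \<bullet> b) \<in> L ` inner_graph_hull G"
      by (force simp: L_def)
    from x[OF this] show ?thesis
      unfolding power2_norm_eq_inner by (simp add: inner_simps inner_commute field_simps)
  qed
  then show ?thesis
    by blast
qed

lemma maximal_monotone_memI:
  assumes M: "maximal_monotone M" and rel: "\<And>a b. b \<in> M a \<Longrightarrow> 0 \<le> (a - x) \<bullet> (b - u)"
  shows "u \<in> M x"
proof -
  have rel': "0 \<le> (x - a) \<bullet> (u - b)" if "b \<in> M a" for a b
    using rel[OF that] by (simp add: inner_simps algebra_simps)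
  define B where "B = M(x := insert u (M x))"
  have "monotone_operator B"
    using M rel rel' unfolding maximal_monotone_def monotone_operator_def B_def by auto
  moreover have "\<forall>a. M a \<subseteq> B a"
    by (auto simp: B_def)
  ultimately have "B = M"
    using M by (auto simp: maximal_monotone_def)
  then have "B x = M x" by simp
  then show ?thesis
    by (auto simp: B_def)
qed

lemma mem_resolvent_set_scale:
  "x \<in> resolvent_set (scale_operator c A) z \<longleftrightarrow> (\<exists>u\<in>A x. z = x + c *\<^sub>R u)"
  by (auto simp: resolvent_set_def inverse_operator_def scale_operator_def)

lemma resolvent_set_scale_unique:
  assumes A: "monotone_operator A" and c: "0 < c"
    and x: "x \<in> resolvent_set (scale_operator c A) z"
  shows "resolvent_set (scale_operator c A) z = {x}"
proof -
  have "x' = x" if x': "x' \<in> resolvent_set (scale_operator c A) z" for x'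
  proof -
    obtain u where u: "u \<in> A x" "z = x + c *\<^sub>R u"
      using x unfolding mem_resolvent_set_scale by blast
    obtain u' where u': "u' \<in> A x'" "z = x' + c *\<^sub>R u'"
      using x' unfolding mem_resolvent_set_scale by blast
    have "0 \<le> c * ((x - x') \<bullet> (u - u'))"
      using A u(1) u'(1) c by (simp add: monotone_operator_def)
    also have "\<dots> = (x - x') \<bullet> (c *\<^sub>R u - c *\<^sub>R u')"
      by (simp add: inner_simps algebra_simps)
    also have "c *\<^sub>R u - c *\<^sub>R u' = - (x - x')"
      using u(2) u'(2) by (simp add: algebra_simps)
    finally show ?thesis
      by (metis eq_iff_diff_eq_0 inner_ge_zero inner_gt_zero_iff inner_minus_right neg_0_le_iff_le not_le)
  qed
  then show ?thesis
    using x by blast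
qed

text \<open>The antidiagonal point is found for the rescaled and translated graph of all \<open>(a, c b - z)\<close> with
  \<open>b \<in> M a\<close>: being related to that graph means that \<open>(x, (z - x) / c)\<close> is related to the graph of
  \<open>M\<close>, and maximality puts it there.\<close>

lemma minty_surjectivity:
  fixes M :: "'b::{real_inner, complete_space} \<Rightarrow> 'b set"
  assumes M: "maximal_monotone M" and c: "0 < c"
  shows "\<exists>x. \<exists>u\<in>M x. z = x + c *\<^sub>R u"
proof -
  define G where "G = {(a, c *\<^sub>R b - z) | a b. b \<in> M a}"
  have "0 \<le> (a - a') \<bullet> (b - b')" if G: "(a, b) \<in> G" "(a', b') \<in> G" for a b a' b'
  proof -
    obtain e e' where e: "e \<in> M a" "b = c *\<^sub>R e - z" and e': "e' \<in> M a'" "b' = c *\<^sub>R e' - z"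
      using G by (auto simp: G_def)
    have "0 \<le> (a - a') \<bullet> (e - e')"
      using M e(1) e'(1) by (auto simp: maximal_monotone_def monotone_operator_def)
    then have "0 \<le> c * ((a - a') \<bullet> (e - e'))"
      using c by simp
    also have "\<dots> = (a - a') \<bullet> (b - b')"
      unfolding e(2) e'(2) by (simp add: inner_simps algebra_simps)
    finally show ?thesis .
  qed
  then obtain x where x: "\<And>a b. (a, b) \<in> G \<Longrightarrow> 0 \<le> (a - x) \<bullet> (b + x)"
    using monotone_graph_related_antidiagonal_point[of G] by blast
  have "(1 / c) *\<^sub>R (z - x) \<in> M x"
  proof (rule maximal_monotone_memI[OF M])
    fix a b assume "b \<in> M a"
    then have "0 \<le> (a - x) \<bullet> ((c *\<^sub>R b - z) + x)"
      by (intro x) (auto simp: G_def)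
    also have "(c *\<^sub>R b - z) + x = c *\<^sub>R (b - (1 / c) *\<^sub>R (z - x))"
      using c by (simp add: algebra_simps)
    finally show "0 \<le> (a - x) \<bullet> (b - (1 / c) *\<^sub>R (z - x))"
      using c by (simp add: zero_le_mult_iff)
  qed
  moreover have "z = x + c *\<^sub>R ((1 / c) *\<^sub>R (z - x))"
    using c by simp
  ultimately show ?thesis
    by blast
qed

section \<open>The Yosida approximation\<close>

text \<open>This is the description of the Yosida approximation as the inverse of \<open>c I + M\<inverse>\<close>. It replaces the
  resolvent in all that follows. Minty's theorem is needed for the forward direction: without a
  point in the resolvent set, the value of \<open>yosida\<close> would be arbitrary.\<close>

lemma yosida_eq_iff:
  fixes M :: "'b::{real_inner, complete_space} \<Rightarrow> 'b set"
  assumes M: "maximal_monotone M" and c: "0 < c"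
  shows "yosida c M z = u \<longleftrightarrow> u \<in> M (z - c *\<^sub>R u)"
proof -
  have val: "yosida c M (x + c *\<^sub>R w) = w" if "w \<in> M x" for x w
  proof -
    have "x \<in> resolvent_set (scale_operator c M) (x + c *\<^sub>R w)"
      using that by (auto simp: mem_resolvent_set_scale)
    then have "resolvent (scale_operator c M) (x + c *\<^sub>R w) = x"
      using M c resolvent_set_scale_unique by (fastforce simp: resolvent_def maximal_monotone_def)
    then show ?thesis
      using c by (simp add: yosida_def)
  qed
  obtain x w where xw: "w \<in> M x" "z = x + c *\<^sub>R w"
    using minty_surjectivity[OF M c] by metis
  show ?thesis
  proof
    assume "yosida c M z = u"
    then show "u \<in> M (z - c *\<^sub>R u)"
      using xw val by auto
  next
    assume "u \<in> M (z - c *\<^sub>R u)"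
    from val[OF this] show "yosida c M z = u"
      by simp
  qed
qed

lemma yosida_cocoercive:
  fixes M :: "'b::{real_inner, complete_space} \<Rightarrow> 'b set"
  assumes M: "maximal_monotone M" and c: "0 < c"
  shows "c * (norm (yosida c M z - yosida c M w))\<^sup>2 \<le> (yosida c M z - yosida c M w) \<bullet> (z - w)"
proof -
  define p q where "p = yosida c M z" and "q = yosida c M w"
  have "p \<in> M (z - c *\<^sub>R p)" "q \<in> M (w - c *\<^sub>R q)"
    using yosida_eq_iff[OF M c] by (auto simp: p_def q_def)
  then have "0 \<le> ((z - c *\<^sub>R p) - (w - c *\<^sub>R q)) \<bullet> (p - q)"
    using M by (auto simp: maximal_monotone_def monotone_operator_def)
  then show ?thesis
    unfolding p_def[symmetric] q_def[symmetric] power2_norm_eq_inner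
    by (simp add: inner_simps inner_commute algebra_simps)
qed


section \<open>Weak cluster points of bounded families\<close>

lemma converges_weakly_iff_inner:
  fixes v :: "nat \<Rightarrow> 'b::{real_inner, complete_space}"
  shows "converges_weakly v l \<longleftrightarrow> (\<forall>x. (\<lambda>k. v k \<bullet> x) \<longlonglongrightarrow> l \<bullet> x)"
proof
  assume "converges_weakly v l"
  then show "\<forall>x. (\<lambda>k. v k \<bullet> x) \<longlonglongrightarrow> l \<bullet> x"
    unfolding converges_weakly_def using bounded_linear_inner_left by blast
next
  assume "\<forall>x. (\<lambda>k. v k \<bullet> x) \<longlonglongrightarrow> l \<bullet> x"
  then have "(\<lambda>k. f (v k)) \<longlonglongrightarrow> f l" if f: "bounded_linear f" for f :: "'b \<Rightarrow> real"
    using riesz_representation[OF f] by (auto simp: inner_commute)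
  then show "converges_weakly v l"
    by (simp add: converges_weakly_def)
qed

text \<open>Each \<open>v k\<close> is viewed as the function \<open>x \<mapsto> v k \<bullet> x\<close> in the product of the intervals
  \<open>[- B |x|, B |x|]\<close>, which is compact by Tychonoff. A cluster point in this product is a pointwise
  limit along a finer filter \<open>G\<close>, hence linear and bounded, and Riesz turns it into a vector.
  A finer filter takes the role of a subsequence; a weakly convergent subsequence could not be
  extracted this way, because the product topology is in general not sequentially compact.\<close>

lemma bounded_weak_cluster_point:
  fixes v :: "'i \<Rightarrow> 'b::{real_inner, complete_space}"
  assumes bound: "\<And>k. norm (v k) \<le> B" and F: "F \<noteq> bot"
  shows "\<exists>G l. G \<le> F \<and> G \<noteq> bot \<and> (\<forall>x. ((\<lambda>k. v k \<bullet> x) \<longlongrightarrow> l \<bullet> x) G)"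
proof -
  define e :: "'i \<Rightarrow> 'b \<Rightarrow> real" where "e k x = v k \<bullet> x" for k x
  define K where "K = Pi\<^sub>E UNIV (\<lambda>x::'b. {- (B * norm x)..B * norm x})"
  have e_bound: "\<bar>e k x\<bar> \<le> B * norm x" for k x
    unfolding e_def using Cauchy_Schwarz_ineq2[of "v k" x] mult_right_mono[OF bound[of k] norm_ge_zero[of x]]
    by linarith
  have "compact K"
    unfolding K_def compactin_euclidean_iff[symmetric] euclidean_product_topology[symmetric]
    by (simp add: compactin_PiE)
  moreover have "e k \<in> K" for k
    using e_bound unfolding K_def by (auto simp: abs_le_iff) (smt (verit) e_bound)
  then have "eventually (\<lambda>h. h \<in> K) (filtermap e F)"
    by (simp add: eventually_filtermap)
  moreover have "filtermap e F \<noteq> bot"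
    using F by (simp add: filtermap_bot_iff)
  ultimately obtain g where gK: "g \<in> K" and g: "inf (nhds g) (filtermap e F) \<noteq> bot"
    unfolding compact_filter by blast
  define G where "G = inf F (filtercomap e (nhds g))"
  \<comment> \<open>A set in \<open>F\<close> missing the preimage of a neighbourhood of \<open>g\<close> has an image missing that
    neighbourhood, which is impossible for a cluster point.\<close>
  have "G \<noteq> bot"
  proof
    assume "G = bot"
    then have "eventually (\<lambda>_. False) (inf F (filtercomap e (nhds g)))"
      by (simp add: G_def)
    then obtain P Q where PQ: "eventually P F" "eventually Q (filtercomap e (nhds g))"
      "\<And>k. P k \<Longrightarrow> Q k \<Longrightarrow> False"
      unfolding eventually_inf by blast
    then obtain R where R: "eventually R (nhds g)" "\<And>k. R (e k) \<Longrightarrow> Q k"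
      unfolding eventually_filtercomap by blast
    have "eventually (\<lambda>h. \<exists>k. P k \<and> h = e k) (filtermap e F)"
      unfolding eventually_filtermap using PQ(1) by (rule eventually_mono) blast
    then have "eventually (\<lambda>_. False) (inf (nhds g) (filtermap e F))"
      unfolding eventually_inf using R PQ(3) by blast
    then show False
      using g by (simp add: trivial_limit_def)
  qed
  have "filterlim e (nhds g) G"
    unfolding filterlim_def G_def
    by (metis filtermap_filtercomap filtermap_mono inf_le2 order_trans)
  have coord: "((\<lambda>k. v k \<bullet> x) \<longlongrightarrow> g x) G" for x
  proof -
    have "((\<lambda>k. e k x) \<longlongrightarrow> g x) G"
    proof (rule topological_tendstoI)
      fix S :: "real set" assume S: "open S" "g x \<in> S"
      have "open ((\<lambda>h::'b \<Rightarrow> real. h x) -` S)"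
        using S(1) by (rule open_vimage) simp
      then have "eventually (\<lambda>k. e k \<in> (\<lambda>h. h x) -` S) G"
        using \<open>filterlim e (nhds g) G\<close> S(2) by (intro topological_tendstoD) auto
      then show "eventually (\<lambda>k. e k x \<in> S) G"
        by simp
    qed
    then show ?thesis
      by (simp add: e_def)
  qed
  have "bounded_linear g"
  proof (rule bounded_linear_intro)
    fix x y
    have "((\<lambda>k. v k \<bullet> (x + y)) \<longlongrightarrow> g x + g y) G"
      unfolding inner_add_right by (intro tendsto_intros coord)
    then show "g (x + y) = g x + g y"
      using tendsto_unique[OF \<open>G \<noteq> bot\<close> coord] by blast
  next
    fix r x
    have "((\<lambda>k. v k \<bullet> (r *\<^sub>R x)) \<longlongrightarrow> r *\<^sub>R g x) G"
      unfolding inner_scaleR_right real_scaleR_def by (intro tendsto_intros coord)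
    then show "g (r *\<^sub>R x) = r *\<^sub>R g x"
      using tendsto_unique[OF \<open>G \<noteq> bot\<close> coord] by blast
  next
    fix x
    have "g x \<in> {- (B * norm x)..B * norm x}"
      using gK by (auto simp: K_def)
    then show "norm (g x) \<le> norm x * B"
      by (auto simp: mult.commute)
  qed
  then obtain l where "\<And>x. g x = l \<bullet> x"
    using riesz_representation by blast
  then have "\<forall>x. ((\<lambda>k. v k \<bullet> x) \<longlongrightarrow> l \<bullet> x) G"
    using coord by simp
  moreover have "G \<le> F"
    by (simp add: G_def)
  ultimately show ?thesis
    using \<open>G \<noteq> bot\<close> by blast
qed

section \<open>The Krasnoselskii--Mann iteration\<close>

text \<open>If \<open>T l \<noteq> l\<close>, then weak convergence makes \<open>v k\<close> asymptotically closer to \<open>l\<close> than to \<open>T l\<close>, by the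
  fixed amount \<open>|l - T l|\<^sup>2\<close> in squared distance. But \<open>|T (v k) - T l| \<le> |v k - l|\<close>, and
  \<open>T (v k)\<close> is asymptotically \<open>v k\<close>. Stating this along a filter \<open>G\<close> allows
  its use at cluster points.\<close>

lemma nonexpansive_demiclosed:
  fixes v :: "'i \<Rightarrow> 'b::real_inner"
  assumes nonexp: "\<And>x y. norm (T x - T y) \<le> norm (x - y)"
    and weak: "\<And>x. ((\<lambda>k. v k \<bullet> x) \<longlongrightarrow> l \<bullet> x) G"
    and residual: "((\<lambda>k. norm (v k - T (v k))) \<longlongrightarrow> 0) G"
    and bound: "\<And>k. norm (v k - l) \<le> D"
    and G: "G \<noteq> bot"
  shows "T l = l"
proof -
  define r where "r k = norm (v k - T (v k))" for k
  have key: "(norm (l - T l))\<^sup>2 \<le> r k * (r k + 2 * D) - 2 * (v k \<bullet> (l - T l) - l \<bullet> (l - T l))" for k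
  proof -
    have "norm (v k - T l) \<le> r k + norm (v k - l)"
      using norm_triangle_ineq[of "v k - T (v k)" "T (v k) - T l"] nonexp[of "v k" l]
      by (simp add: r_def)
    then have "(norm (v k - T l))\<^sup>2 \<le> (r k + norm (v k - l))\<^sup>2"
      by (intro power_mono) auto
    also have "\<dots> = (norm (v k - l))\<^sup>2 + r k * (r k + 2 * norm (v k - l))"
      by (simp add: power2_eq_square algebra_simps)
    also have "\<dots> \<le> (norm (v k - l))\<^sup>2 + r k * (r k + 2 * D)"
      using bound[of k] by (intro add_left_mono mult_left_mono) (auto simp: r_def)
    finally have "(norm (v k - T l))\<^sup>2 \<le> (norm (v k - l))\<^sup>2 + r k * (r k + 2 * D)" .
    then show ?thesis
      unfolding power2_norm_eq_inner by (simp add: inner_simps inner_commute algebra_simps)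
  qed
  have "((\<lambda>k. r k * (r k + 2 * D) - 2 * (v k \<bullet> (l - T l) - l \<bullet> (l - T l)))
      \<longlongrightarrow> 0 * (0 + 2 * D) - 2 * (l \<bullet> (l - T l) - l \<bullet> (l - T l))) G"
    unfolding r_def by (intro tendsto_intros residual weak)
  then have "(norm (l - T l))\<^sup>2 \<le> 0 * (0 + 2 * D) - 2 * (l \<bullet> (l - T l) - l \<bullet> (l - T l))"
    by (rule tendsto_lowerbound) (use key G in auto)
  then show ?thesis
    by simp
qed

lemma norm_convex_combination_square:
  fixes x y :: "'b::real_inner"
  shows "(norm ((1 - a) *\<^sub>R x + a *\<^sub>R y))\<^sup>2
    = (1 - a) * (norm x)\<^sup>2 + a * (norm y)\<^sup>2 - a * (1 - a) * (norm (x - y))\<^sup>2"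
  unfolding power2_norm_eq_inner
  by (simp add: inner_simps inner_commute algebra_simps power2_eq_square)

locale krasnoselskii_mann =
  fixes T :: "'b::{real_inner, complete_space} \<Rightarrow> 'b"
    and \<alpha> :: "nat \<Rightarrow> real"
    and v :: "nat \<Rightarrow> 'b"
  assumes nonexpansive: "norm (T x - T y) \<le> norm (x - y)"
    and relaxation: "\<alpha> k \<in> {0..1}"
    and iteration: "v (Suc k) = (1 - \<alpha> k) *\<^sub>R v k + \<alpha> k *\<^sub>R T (v k)"
begin

lemma step_identity:
  "(norm (v (Suc k) - l))\<^sup>2 = (1 - \<alpha> k) * (norm (v k - l))\<^sup>2 + \<alpha> k * (norm (T (v k) - l))\<^sup>2
     - \<alpha> k * (1 - \<alpha> k) * (norm (v k - T (v k)))\<^sup>2"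
proof -
  have "v (Suc k) - l = (1 - \<alpha> k) *\<^sub>R (v k - l) + \<alpha> k *\<^sub>R (T (v k) - l)"
    by (simp add: iteration algebra_simps)
  then show ?thesis
    using norm_convex_combination_square[of "\<alpha> k" "v k - l" "T (v k) - l"] by simp
qed

text \<open>Besides the nonincreasing distance to a fixed point, the step records how much is gained: the
  squared residual weighted by \<open>\<alpha> k (1 - \<alpha> k)\<close>. Summation of this gain forces the residual to zero.\<close>

lemma step_decrease:
  assumes "T l = l"
  shows "(norm (v (Suc k) - l))\<^sup>2 + \<alpha> k * (1 - \<alpha> k) * (norm (v k - T (v k)))\<^sup>2 \<le> (norm (v k - l))\<^sup>2"
proof -
  have "(norm (T (v k) - l))\<^sup>2 \<le> (norm (v k - l))\<^sup>2"
    using nonexpansive[of "v k" l] assms by (intro power_mono) auto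
  then have "\<alpha> k * (norm (T (v k) - l))\<^sup>2 \<le> \<alpha> k * (norm (v k - l))\<^sup>2"
    using relaxation[of k] by (intro mult_left_mono) auto
  then show ?thesis
    by (simp add: step_identity algebra_simps)
qed

lemma fejer_monotone:
  assumes "T l = l"
  shows "decseq (\<lambda>k. norm (v k - l))"
proof (rule decseq_SucI)
  fix k
  have "0 \<le> \<alpha> k * (1 - \<alpha> k) * (norm (v k - T (v k)))\<^sup>2"
    using relaxation[of k] by auto
  then have "(norm (v (Suc k) - l))\<^sup>2 \<le> (norm (v k - l))\<^sup>2"
    using step_decrease[OF assms, of k] by linarith
  then show "norm (v (Suc k) - l) \<le> norm (v k - l)"
    by (rule power2_le_imp_le) simp
qed

lemma distance_convergent:
  assumes "T l = l"
  shows "\<exists>d. (\<lambda>k. norm (v k - l)) \<longlonglongrightarrow> d"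
  using decseq_convergent[OF fejer_monotone[OF assms], of 0] by auto

lemma residual_decseq: "decseq (\<lambda>k. norm (v k - T (v k)))"
proof (rule decseq_SucI)
  fix k
  have "v (Suc k) - T (v k) = (1 - \<alpha> k) *\<^sub>R (v k - T (v k))"
    and "v k - v (Suc k) = \<alpha> k *\<^sub>R (v k - T (v k))"
    by (simp_all add: iteration algebra_simps)
  then have "norm (v (Suc k) - T (v k)) + norm (v k - v (Suc k))
      = (1 - \<alpha> k) * norm (v k - T (v k)) + \<alpha> k * norm (v k - T (v k))"
    using relaxation[of k] by simp
  also have "\<dots> = norm (v k - T (v k))"
    by (simp add: algebra_simps)
  finally have "norm (v (Suc k) - T (v k)) + norm (v k - v (Suc k)) = norm (v k - T (v k))" .
  moreover have "norm (v (Suc k) - T (v (Suc k)))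
      \<le> norm (v (Suc k) - T (v k)) + norm (T (v k) - T (v (Suc k)))"
    using norm_triangle_ineq[of "v (Suc k) - T (v k)" "T (v k) - T (v (Suc k))"] by simp
  ultimately show "norm (v (Suc k) - T (v (Suc k))) \<le> norm (v k - T (v k))"
    using nonexpansive[of "v k" "v (Suc k)"] by linarith
qed

text \<open>The residuals are nonincreasing, so it suffices that they become small once. If they stayed above
  \<open>e\<close>, the gains in \<open>step_decrease\<close> would add up to \<open>e\<^sup>2\<close> times a divergent sum, while the total
  gain is bounded by a squared distance to \<open>l\<close>.\<close>

lemma residual_tendsto_zero:
  assumes fixed: "T l = l"
    and diverges: "filterlim (\<lambda>n. \<Sum>k = 1..n. \<alpha> k * (1 - \<alpha> k)) at_top sequentially"
  shows "(\<lambda>k. norm (v k - T (v k))) \<longlonglongrightarrow> 0"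
proof (rule LIMSEQ_I)
  fix e :: real assume e: "0 < e"
  have "\<exists>k. norm (v k - T (v k)) < e"
  proof (rule ccontr)
    assume "\<not> (\<exists>k. norm (v k - T (v k)) < e)"
    then have large: "e\<^sup>2 \<le> (norm (v k - T (v k)))\<^sup>2" for k
      using e by (intro power_mono) (auto simp: not_less)
    \<comment> \<open>The sum starts at index 1, so the telescoping starts from \<open>v 1\<close>.\<close>
    have sum_bound: "(norm (v (Suc n) - l))\<^sup>2 + e\<^sup>2 * (\<Sum>k = 1..n. \<alpha> k * (1 - \<alpha> k)) \<le> (norm (v 1 - l))\<^sup>2" for n
    proof (induction n)
      case (Suc n)
      have "\<alpha> (Suc n) * (1 - \<alpha> (Suc n)) * e\<^sup>2
          \<le> \<alpha> (Suc n) * (1 - \<alpha> (Suc n)) * (norm (v (Suc n) - T (v (Suc n))))\<^sup>2"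
        using large relaxation[of "Suc n"] by (intro mult_left_mono) auto
      with Suc.IH step_decrease[OF fixed, of "Suc n"] show ?case
        by (simp add: algebra_simps)
    qed simp
    have "(\<Sum>k = 1..n. \<alpha> k * (1 - \<alpha> k)) \<le> (norm (v 1 - l))\<^sup>2 / e\<^sup>2" for n
    proof -
      have "e\<^sup>2 * (\<Sum>k = 1..n. \<alpha> k * (1 - \<alpha> k)) \<le> (norm (v 1 - l))\<^sup>2"
        using sum_bound[of n] zero_le_power2[of "norm (v (Suc n) - l)"] by linarith
      then show ?thesis
        using e by (simp add: pos_le_divide_eq mult.commute)
    qed
    moreover have "eventually (\<lambda>n. (norm (v 1 - l))\<^sup>2 / e\<^sup>2 < (\<Sum>k = 1..n. \<alpha> k * (1 - \<alpha> k))) sequentially"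
      using diverges by (simp add: filterlim_at_top_dense)
    ultimately show False
      by (auto simp: eventually_sequentially not_less[symmetric])
  qed
  then obtain k0 where "norm (v k0 - T (v k0)) < e"
    by blast
  then have "norm (v k - T (v k)) < e" if "k0 \<le> k" for k
    using decseqD[OF residual_decseq that] by linarith
  then show "\<exists>k0. \<forall>k\<ge>k0. norm (norm (v k - T (v k)) - 0) < e"
    by auto
qed

text \<open>This is Opial's argument: since the distances to both fixed points converge, so does their
  difference of squares, and with it \<open>v k \<bullet> (l - l')\<close>. The limit of the latter is \<open>l \<bullet> (l - l')\<close>
  along one filter and \<open>l' \<bullet> (l - l')\<close> along the other.\<close>

lemma weak_cluster_point_unique:
  assumes fixed: "T l = l" "T l' = l'"
    and G: "G \<noteq> bot" "G \<le> sequentially" "\<And>x. ((\<lambda>k. v k \<bullet> x) \<longlongrightarrow> l \<bullet> x) G"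
    and G': "G' \<noteq> bot" "G' \<le> sequentially" "\<And>x. ((\<lambda>k. v k \<bullet> x) \<longlongrightarrow> l' \<bullet> x) G'"
  shows "l = l'"
proof -
  obtain d d' where d: "(\<lambda>k. norm (v k - l)) \<longlonglongrightarrow> d" and d': "(\<lambda>k. norm (v k - l')) \<longlonglongrightarrow> d'"
    using distance_convergent fixed by metis
  have "v k \<bullet> (l - l') = ((norm (v k - l'))\<^sup>2 - (norm (v k - l))\<^sup>2 + ((norm l)\<^sup>2 - (norm l')\<^sup>2)) / 2" for k
    unfolding power2_norm_eq_inner by (simp add: inner_simps inner_commute algebra_simps)
  moreover have "(\<lambda>k. ((norm (v k - l'))\<^sup>2 - (norm (v k - l))\<^sup>2 + ((norm l)\<^sup>2 - (norm l')\<^sup>2)) / 2)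
      \<longlonglongrightarrow> (d'\<^sup>2 - d\<^sup>2 + ((norm l)\<^sup>2 - (norm l')\<^sup>2)) / 2"
    by (intro tendsto_intros d d') simp
  ultimately obtain r where r: "(\<lambda>k. v k \<bullet> (l - l')) \<longlonglongrightarrow> r"
    by auto
  have "l \<bullet> (l - l') = r"
    using G(1) G(3) tendsto_mono[OF G(2) r] by (rule tendsto_unique)
  moreover have "l' \<bullet> (l - l') = r"
    using G'(1) G'(3) tendsto_mono[OF G'(2) r] by (rule tendsto_unique)
  ultimately have "(l - l') \<bullet> (l - l') = 0"
    by (simp add: inner_diff_left)
  then show ?thesis
    by simp
qed

text \<open>Every filter finer than \<open>sequentially\<close> has a cluster point of \<open>v\<close> that is a fixed point of \<open>T\<close>,
  and all these cluster points agree with the one, \<open>l\<close>, found along \<open>sequentially\<close> itself. If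
  \<open>v k \<bullet> x\<close> failed to converge to \<open>l \<bullet> x\<close>, the indices at which it stays away from that value would
  generate such a filter with a cluster point other than \<open>l\<close>.\<close>

theorem converges_weakly_to_fixed_point:
  assumes fixed: "T p = p"
    and diverges: "filterlim (\<lambda>n. \<Sum>k = 1..n. \<alpha> k * (1 - \<alpha> k)) at_top sequentially"
  shows "\<exists>l. converges_weakly v l \<and> T l = l"
proof -
  have dist_p: "norm (v k - p) \<le> norm (v 0 - p)" for k
    using decseqD[OF fejer_monotone[OF fixed], of 0 k] by simp
  have bound: "norm (v k) \<le> norm (v 0 - p) + norm p" for k
    using norm_triangle_ineq[of "v k - p" p] dist_p[of k] by simp
  have cluster: "\<exists>G l. G \<noteq> bot \<and> G \<le> F \<and> T l = l \<and> (\<forall>x. ((\<lambda>k. v k \<bullet> x) \<longlongrightarrow> l \<bullet> x) G)"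
    if F: "F \<noteq> bot" "F \<le> sequentially" for F
  proof -
    obtain G l where G: "G \<le> F" "G \<noteq> bot" and l: "\<And>x. ((\<lambda>k. v k \<bullet> x) \<longlongrightarrow> l \<bullet> x) G"
      using bounded_weak_cluster_point[of v, OF bound F(1)] by blast
    have "((\<lambda>k. norm (v k - T (v k))) \<longlongrightarrow> 0) G"
      using residual_tendsto_zero[OF fixed diverges] G(1) F(2) by (metis order_trans tendsto_mono)
    moreover have "norm (v k - l) \<le> norm (v 0 - p) + norm p + norm l" for k
      using norm_triangle_ineq4[of "v k" l] bound[of k] by linarith
    ultimately have "T l = l"
      using nonexpansive_demiclosed[of T v l G] nonexpansive l G(2) by blast
    then show ?thesis
      using G l by blast
  qed
  obtain G l where G: "G \<noteq> bot" "G \<le> sequentially" and l: "T l = l" "\<And>x. ((\<lambda>k. v k \<bullet> x) \<longlongrightarrow> l \<bullet> x) G"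
    using cluster[of sequentially] by auto
  have "(\<lambda>k. v k \<bullet> x) \<longlonglongrightarrow> l \<bullet> x" for x
  proof (rule ccontr)
    assume "\<not> (\<lambda>k. v k \<bullet> x) \<longlonglongrightarrow> l \<bullet> x"
    then obtain e where e: "0 < e" "\<not> eventually (\<lambda>k. dist (v k \<bullet> x) (l \<bullet> x) < e) sequentially"
      unfolding tendsto_iff by blast
    define F where "F = inf sequentially (principal {k. \<not> dist (v k \<bullet> x) (l \<bullet> x) < e})"
    have "F \<noteq> bot"
      using e(2) unfolding F_def trivial_limit_def eventually_inf_principal by simp
    moreover have "F \<le> sequentially"
      by (simp add: F_def)
    ultimately obtain G' l' where G': "G' \<noteq> bot" "G' \<le> F"
      and l': "T l' = l'" "\<And>x. ((\<lambda>k. v k \<bullet> x) \<longlongrightarrow> l' \<bullet> x) G'"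
      using cluster by blast
    have "l' = l"
      using weak_cluster_point_unique[OF l'(1) l(1) G'(1) _ l'(2) G l(2)] G'(2) \<open>F \<le> sequentially\<close>
      by (meson order_trans)
    then have "eventually (\<lambda>k. dist (v k \<bullet> x) (l \<bullet> x) < e) G'"
      using l'(2)[of x] e(1) by (simp add: tendsto_iff)
    moreover have "eventually (\<lambda>k. \<not> dist (v k \<bullet> x) (l \<bullet> x) < e) F"
      by (simp add: F_def eventually_inf_principal)
    then have "eventually (\<lambda>k. \<not> dist (v k \<bullet> x) (l \<bullet> x) < e) G'"
      using G'(2) by (rule filter_leD[rotated])
    ultimately have "eventually (\<lambda>_. False) G'"
      by eventually_elim simp
    then show False
      using G'(1) by (simp add: trivial_limit_def)
  qed
  then show ?thesis
    using l(1) converges_weakly_iff_inner by blast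
qed

end

section \<open>The dual fixed-point map\<close>

text \<open>Put \<open>s = lam \<mu>\<close>, \<open>d = u - w\<close> and \<open>g = C C\<^sup>T d\<close>. The arguments of the Yosida approximation differ by
  \<open>(d - s g) / \<mu>\<close>, and cocoercivity with constant \<open>1 / \<mu>\<close> cancels the factor \<open>1 / \<mu>\<close>, leaving
  \<open>|N u - N w| \<le> |d - s g|\<close>. The square of the right-hand side expands with \<open>g \<bullet> d = |C\<^sup>T d|\<^sup>2\<close> and
  \<open>|g| \<le> |C| |C\<^sup>T d|\<close>.\<close>

lemma dual_map_estimate:
  fixes C :: "'a::{real_inner, complete_space} \<Rightarrow> 'b::{real_inner, complete_space}"
  assumes C: "bounded_linear C" and M: "maximal_monotone M" and mu: "0 < \<mu>"
    and N: "\<And>w. N w = yosida (1 / \<mu>) M (C y + ((1 / \<mu>) *\<^sub>R w - lam *\<^sub>R C (adjoint C w)))"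
  shows "(norm (N u - N w))\<^sup>2 \<le> (norm (u - w))\<^sup>2
    - lam * \<mu> * (2 - lam * \<mu> * (onorm C)\<^sup>2) * (norm (adjoint C (u - w)))\<^sup>2"
proof -
  interpret C: bounded_linear C by fact
  define d p g s where "d = u - w" and "p = N u - N w" and "g = C (adjoint C d)" and "s = lam * \<mu>"
  have "(1 / \<mu>) * (norm p)\<^sup>2 \<le> p \<bullet> ((C y + ((1 / \<mu>) *\<^sub>R u - lam *\<^sub>R C (adjoint C u)))
      - (C y + ((1 / \<mu>) *\<^sub>R w - lam *\<^sub>R C (adjoint C w))))"
    unfolding p_def N using mu by (intro yosida_cocoercive[OF M]) auto
  also have "(C y + ((1 / \<mu>) *\<^sub>R u - lam *\<^sub>R C (adjoint C u)))
      - (C y + ((1 / \<mu>) *\<^sub>R w - lam *\<^sub>R C (adjoint C w))) = (1 / \<mu>) *\<^sub>R (d - s *\<^sub>R g)"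
    using mu by (simp add: d_def g_def s_def adjoint_diff[OF C] C.diff algebra_simps)
  finally have "(norm p)\<^sup>2 \<le> p \<bullet> (d - s *\<^sub>R g)"
    using mu by (simp add: divide_le_cancel)
  also have "\<dots> \<le> norm p * norm (d - s *\<^sub>R g)"
    by (rule norm_cauchy_schwarz)
  finally have "norm p \<le> norm (d - s *\<^sub>R g)"
    by (cases "p = 0") (auto simp: power2_eq_square)
  then have "(norm p)\<^sup>2 \<le> (norm (d - s *\<^sub>R g))\<^sup>2"
    by (intro power_mono) auto
  also have "\<dots> = (norm d)\<^sup>2 - 2 * s * (g \<bullet> d) + s\<^sup>2 * (norm g)\<^sup>2"
    unfolding power2_norm_eq_inner by (simp add: inner_simps inner_commute power2_eq_square algebra_simps)
  also have "g \<bullet> d = (norm (adjoint C d))\<^sup>2"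
    unfolding g_def adjoint_inner[OF C] power2_norm_eq_inner ..
  also have "s\<^sup>2 * (norm g)\<^sup>2 \<le> s\<^sup>2 * (onorm C * norm (adjoint C d))\<^sup>2"
    unfolding g_def using onorm[OF C] by (intro mult_left_mono power_mono) auto
  finally show ?thesis
    by (simp add: p_def d_def s_def power2_eq_square algebra_simps)
qed

text \<open>The term \<open>w / \<mu>\<close> in the argument of the Yosida approximation is there to cancel the shift by
  \<open>(1 / \<mu>) w\<close> in its characterisation, so that precisely \<open>C (y - lam C\<^sup>T w)\<close> remains.\<close>

lemma dual_map_fixed_point_iff:
  fixes C :: "'a::{real_inner, complete_space} \<Rightarrow> 'b::{real_inner, complete_space}"
  assumes C: "bounded_linear C" and M: "maximal_monotone M" and mu: "0 < \<mu>"
    and N: "\<And>w. N w = yosida (1 / \<mu>) M (C y + ((1 / \<mu>) *\<^sub>R w - lam *\<^sub>R C (adjoint C w)))"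
  shows "N w = w \<longleftrightarrow> w \<in> M (C (y - lam *\<^sub>R adjoint C w))"
proof -
  interpret C: bounded_linear C by fact
  have "C y + ((1 / \<mu>) *\<^sub>R w - lam *\<^sub>R C (adjoint C w)) - (1 / \<mu>) *\<^sub>R w = C (y - lam *\<^sub>R adjoint C w)"
    by (simp add: C.diff C.scale)
  then show ?thesis
    using yosida_eq_iff[OF M, of "1 / \<mu>"] mu unfolding N by simp
qed

section \<open>Convergence of the algorithm\<close>

lemma monotone_composite_operator:
  fixes C :: "'a::{real_inner, complete_space} \<Rightarrow> 'b::real_inner"
  assumes C: "bounded_linear C" and M: "monotone_operator M"
  shows "monotone_operator (composite_operator C M)"
proof -
  interpret C: bounded_linear C by fact
  have "0 \<le> (x - x') \<bullet> (adjoint C u - adjoint C u')" if "u \<in> M (C x)" "u' \<in> M (C x')" for x x' u u'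
  proof -
    have "0 \<le> (C x - C x') \<bullet> (u - u')"
      using M that unfolding monotone_operator_def by blast
    then show ?thesis
      by (simp add: adjoint_inner[OF C] adjoint_diff[OF C] flip: C.diff)
  qed
  then show ?thesis
    unfolding monotone_operator_def composite_operator_def by blast
qed

theorem theorem6:
  fixes C :: "'a::{real_inner, complete_space} \<Rightarrow> 'b::{real_inner, complete_space}"
    and M :: "'b \<Rightarrow> 'b set"
    and lam \<mu> :: real
    and y :: 'a
    and \<alpha> :: "nat \<Rightarrow> real"
    and N :: "'b \<Rightarrow> 'b"
    and v :: "nat \<Rightarrow> 'b"
  assumes C: "bounded_linear C"
    and M: "maximal_monotone M"
    and lam: "0 < lam"
    and y: "resolvent_set (scale_operator lam (composite_operator C M)) y \<noteq> {}"
    and mu: "0 < \<mu>"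
    and lam_mu: "onorm C \<noteq> 0 \<longrightarrow> lam * \<mu> \<in> {0 <..< 2 / (onorm C)\<^sup>2}"
    and alpha: "\<And>k. \<alpha> k \<in> {0 <..< 1}"
    and alpha_sum: "filterlim (\<lambda>n. \<Sum>k = 1..n. \<alpha> k * (1 - \<alpha> k)) at_top sequentially"
    and N: "\<And>w. N w = yosida (1 / \<mu>) M (C y + ((1 / \<mu>) *\<^sub>R w - lam *\<^sub>R C (adjoint C w)))"
    and v: "\<And>k. v (Suc k) = (1 - \<alpha> k) *\<^sub>R v k + \<alpha> k *\<^sub>R N (v k)"
  shows "(\<exists>l. converges_weakly v l \<and> N l = l \<and>
            resolvent_set (scale_operator lam (composite_operator C M)) y = {y - lam *\<^sub>R adjoint C l} \<and>
            resolvent (scale_operator lam (composite_operator C M)) y = y - lam *\<^sub>R adjoint C l) \<and>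
         ((INF k. \<alpha> k) > 0 \<longrightarrow>
            (\<lambda>k. y - lam *\<^sub>R adjoint C (v k))
              \<longlonglongrightarrow> resolvent (scale_operator lam (composite_operator C M)) y)"
proof -
  define R where "R = resolvent_set (scale_operator lam (composite_operator C M)) y"
  define c where "c = lam * \<mu> * (2 - lam * \<mu> * (onorm C)\<^sup>2)"
  have c: "0 < c"
  proof (cases "onorm C = 0")
    case False
    then have "lam * \<mu> * (onorm C)\<^sup>2 < 2"
      using lam_mu by (simp add: pos_less_divide_eq)
    then show ?thesis
      using lam mu by (simp add: c_def)
  qed (use lam mu in \<open>simp add: c_def\<close>)
  note fixed_iff = dual_map_fixed_point_iff[OF C M mu N]
  have estimate: "(norm (N u - N w))\<^sup>2 \<le> (norm (u - w))\<^sup>2 - c * (norm (adjoint C (u - w)))\<^sup>2" for u w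
    unfolding c_def by (rule dual_map_estimate[OF C M mu N])
  have "norm (N u - N w) \<le> norm (u - w)" for u w
  proof (rule power2_le_imp_le)
    show "(norm (N u - N w))\<^sup>2 \<le> (norm (u - w))\<^sup>2"
      using estimate[of u w] c by (smt (verit) mult_nonneg_nonneg zero_le_power2)
  qed simp
  then interpret krasnoselskii_mann N \<alpha> v
    using alpha v by unfold_locales (auto intro: less_imp_le)
  \<comment> \<open>The multiplier \<open>p\<close> of a point in the resolvent set is the fixed point needed to start the
    convergence argument.\<close>
  obtain x where "x \<in> R"
    using y by (auto simp: R_def)
  then obtain p where p: "p \<in> M (C x)" "y = x + lam *\<^sub>R adjoint C p"
    by (auto simp: R_def mem_resolvent_set_scale composite_operator_def)
  then have "N p = p"
    by (simp add: fixed_iff)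
  then obtain l where l: "converges_weakly v l" "N l = l"
    using converges_weakly_to_fixed_point[OF _ alpha_sum] by blast
  have "y - lam *\<^sub>R adjoint C l \<in> R"
    using l(2) unfolding R_def mem_resolvent_set_scale composite_operator_def fixed_iff by fastforce
  then have R: "R = {y - lam *\<^sub>R adjoint C l}"
    unfolding R_def using M C lam
    by (intro resolvent_set_scale_unique monotone_composite_operator) (auto simp: maximal_monotone_def)
  then have resolvent: "resolvent (scale_operator lam (composite_operator C M)) y = y - lam *\<^sub>R adjoint C l"
    by (simp add: resolvent_def R_def)
  have "(\<lambda>k. y - lam *\<^sub>R adjoint C (v k)) \<longlonglongrightarrow> y - lam *\<^sub>R adjoint C l" if inf: "0 < (INF k. \<alpha> k)"
  proof -
    define \<delta> where "\<delta> = (INF k. \<alpha> k)"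
    have \<delta>: "0 < \<delta>" "\<delta> \<le> \<alpha> k" for k
    proof -
      have "bdd_below (range \<alpha>)"
        using alpha by (intro bdd_belowI2[where m = 0]) (auto intro: less_imp_le)
      then show "\<delta> \<le> \<alpha> k"
        unfolding \<delta>_def by (rule cINF_lower) simp
    qed (use inf in \<open>simp add: \<delta>_def\<close>)
    \<comment> \<open>Here the correction term of \<open>estimate\<close> is essential: it bounds \<open>C\<^sup>T (v k - l)\<close> by the decrease of the squared distance to \<open>l\<close>.\<close>
    have gap: "(norm (adjoint C (v k - l)))\<^sup>2
        \<le> ((norm (v k - l))\<^sup>2 - (norm (v (Suc k) - l))\<^sup>2) / (\<delta> * c)" for k
    proof -
      have "\<delta> * (c * (norm (adjoint C (v k - l)))\<^sup>2) \<le> \<alpha> k * (c * (norm (adjoint C (v k - l)))\<^sup>2)"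
        using \<delta>(2) c by (intro mult_right_mono) auto
      also have "\<dots> \<le> \<alpha> k * ((norm (v k - l))\<^sup>2 - (norm (N (v k) - l))\<^sup>2)"
        using estimate[of "v k" l] l(2) alpha[of k] by (intro mult_left_mono) auto
      also have "\<dots> \<le> (norm (v k - l))\<^sup>2 - (norm (v (Suc k) - l))\<^sup>2"
      proof -
        have "0 \<le> \<alpha> k * (1 - \<alpha> k) * (norm (v k - N (v k)))\<^sup>2"
          using alpha[of k] by (simp add: less_imp_le)
        then show ?thesis
          by (simp add: step_identity algebra_simps)
      qed
      finally show ?thesis
        using c \<delta>(1) by (simp add: pos_le_divide_eq mult_ac)
    qed
    obtain d where d: "(\<lambda>k. norm (v k - l)) \<longlonglongrightarrow> d"
      using distance_convergent[OF l(2)] by blast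
    have "(\<lambda>k. ((norm (v k - l))\<^sup>2 - (norm (v (Suc k) - l))\<^sup>2) / (\<delta> * c)) \<longlonglongrightarrow> (d\<^sup>2 - d\<^sup>2) / (\<delta> * c)"
      using c \<delta>(1) by (intro tendsto_intros d LIMSEQ_Suc[OF d]) auto
    then have "(\<lambda>k. ((norm (v k - l))\<^sup>2 - (norm (v (Suc k) - l))\<^sup>2) / (\<delta> * c)) \<longlonglongrightarrow> 0"
      by simp
    then have "(\<lambda>k. (norm (adjoint C (v k - l)))\<^sup>2) \<longlonglongrightarrow> 0"
      by (rule tendsto_sandwich[OF _ _ tendsto_const, rotated 2]) (use gap in auto)
    then have "(\<lambda>k. sqrt ((norm (adjoint C (v k - l)))\<^sup>2)) \<longlonglongrightarrow> sqrt 0"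
      by (rule tendsto_real_sqrt)
    then have "(\<lambda>k. adjoint C (v k) - adjoint C l) \<longlonglongrightarrow> 0"
      by (simp add: tendsto_norm_zero_iff adjoint_diff[OF C])
    then have "(\<lambda>k. adjoint C (v k)) \<longlonglongrightarrow> adjoint C l"
      by (simp add: LIM_zero_iff)
    then show ?thesis
      by (intro tendsto_intros)
  qed
  with l R resolvent show ?thesis
    unfolding R_def by auto
qed

end
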